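(* Let $\mu\in\mathbb{R}$ with $\mu\neq 0$ and let $t>0$. For $\nu\neq 0$, let $T_{\nu,t}$ denote the last zero crossing time in $[0,t]$ of a Brownian motion with drift $\nu$ started at the origin. Then the family of random variables $\{T_{\mu\sqrt{r},t}:r>0\}$ satisfies, as $r\to\infty$, the large deviation principle with speed $v_r=r$ and good rate function $J:\mathbb{R}\to[0,\infty]$ defined by $$J(b):=\begin{cases}\frac{\mu^2}{2}b & \text{if } b\in[0,t],\\ \infty & \text{otherwise.}\end{cases}$$
   Context: Last zero crossing time: for $\nu\neq 0$ and $t>0$, let $B^{\nu}(s)=B(s)+\nu s$, $s\ge 0$, where $B$ is a standard Brownian motion with $B(0)=0$, and let $T_{\nu,t}=\sup\{s\in[0,t]:B^{\nu}(s)=0\}$. It is known (a recalled fact from earlier literature) that the distribution function of $T_{\nu,t}$ is $$P(T_{\nu,t}\leq a)=1-\frac{2}{\pi}\int_0^{\sqrt{\frac{t-a}{a}}}\frac{e^{-\frac{\nu^2}{2}a(1+y^2)}}{1+y^2}\,dy\quad (a\in[0,t]),$$ (with upper limit $\infty$ when $a=0$), and that its density is $$f_{\nu,t}(a)=\left(\frac{e^{-\frac{\nu^2}{2}t}}{\pi\sqrt{a(t-a)}}+\frac{\nu^2}{2\pi}\int_a^t\frac{e^{-\frac{\nu^2}{2}y}}{\sqrt{a(y-a)}}\,dy\right)1_{[0,t]}(a).$$ Large deviation principle (LDP): a family of real-valued random variables $\{W(r):r>0\}$ satisfies the LDP with speed $v_r$ and rate function $I$ if $\lim_{r\to\infty}v_r=\infty$,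 the function $I:\mathbb{R}\to[0,\infty]$ is lower semi-continuous, and $$\limsup_{r\to\infty}\frac{1}{v_r}\log P(W(r)\in C)\leq-\inf_{w\in C}I(w)\quad\text{for all closed sets } C\subseteq\mathbb{R},$$ $$\liminf_{r\to\infty}\frac{1}{v_r}\log P(W(r)\in G)\geq-\inf_{w\in G}I(w)\quad\text{for all open sets } G\subseteq\mathbb{R}.$$ (Conventions: $\log 0=-\infty$ and $\inf\emptyset=\infty$. Only the laws of the $W(r)$ matter.) The rate function $I$ is good if all its level sets $\{w\in\mathbb{R}:I(w)\leq\eta\}$, $\eta\geq 0$, are compact. *)

theory Defs
  imports "HOL-Probability.Probability"
begin

text \<open>A process indexed by reals; only times \<open>s \<ge> 0\<close> matter. Starting point and
  path continuity are required for every outcome, not just almost surely.\<close>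

definition standard_brownian_motion :: "'a measure \<Rightarrow> (real \<Rightarrow> 'a \<Rightarrow> real) \<Rightarrow> bool" where
  "standard_brownian_motion M B \<longleftrightarrow>
     prob_space M \<and>
     (\<forall>s\<ge>0. B s \<in> borel_measurable M) \<and>
     (\<forall>\<omega>\<in>space M. B 0 \<omega> = 0) \<and>
     (\<forall>\<omega>\<in>space M. continuous_on {0..} (\<lambda>s. B s \<omega>)) \<and>
     (\<forall>s u. 0 \<le> s \<and> s < u \<longrightarrow>
        distributed M lborel (\<lambda>\<omega>. B u \<omega> - B s \<omega>) (normal_density 0 (sqrt (u - s)))) \<and>
     (\<forall>(n::nat) \<tau>. 0 \<le> \<tau> 0 \<and> (\<forall>i<n. \<tau> i < \<tau> (Suc i)) \<longrightarrow>
        prob_space.indep_vars M (\<lambda>_. borel) (\<lambda>i \<omega>. B (\<tau> (Suc i)) \<omega> - B (\<tau> i) \<omega>) {..<n})"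

definition drifted :: "(real \<Rightarrow> 'a \<Rightarrow> real) \<Rightarrow> real \<Rightarrow> real \<Rightarrow> 'a \<Rightarrow> real" where
  "drifted B \<nu> s \<omega> = B s \<omega> + \<nu> * s"

definition last_zero :: "(real \<Rightarrow> 'a \<Rightarrow> real) \<Rightarrow> real \<Rightarrow> 'a \<Rightarrow> real" where
  "last_zero X t \<omega> = Sup {s \<in> {0..t}. X s \<omega> = 0}"

text \<open>Logarithm of a probability, with \<open>log 0 = -\<infinity>\<close>; the real \<open>ln\<close> has \<open>ln 0 = 0\<close>.\<close>

definition log_prob :: "real \<Rightarrow> ereal" where
  "log_prob p = (if p = 0 then -\<infinity> else ereal (ln p))"

definition lower_semicontinuous :: "(real \<Rightarrow> ereal) \<Rightarrow> bool" where
  "lower_semicontinuous I \<longleftrightarrow> (\<forall>x. I x \<le> Liminf (at x) I)"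

text \<open>Each \<open>W r\<close> may live on its own probability space \<open>M r\<close>.  An infimum over the
  empty set is \<open>\<infinity>\<close>, the top element of \<^typ>\<open>ereal\<close>.\<close>

definition satisfies_LDP ::
    "(real \<Rightarrow> 'a measure) \<Rightarrow> (real \<Rightarrow> 'a \<Rightarrow> real) \<Rightarrow> (real \<Rightarrow> real) \<Rightarrow> (real \<Rightarrow> ereal) \<Rightarrow> bool" where
  "satisfies_LDP M W v I \<longleftrightarrow>
     (\<forall>r>0. prob_space (M r) \<and> W r \<in> borel_measurable (M r)) \<and>
     filterlim v at_top at_top \<and>
     (\<forall>x. 0 \<le> I x) \<and> lower_semicontinuous I \<and>
     (\<forall>C. closed C \<longrightarrow>
        Limsup at_top (\<lambda>r. ereal (1 / v r) * log_prob (measure (M r) {\<omega> \<in> space (M r). W r \<omega> \<in> C}))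
          \<le> - (INF w\<in>C. I w)) \<and>
     (\<forall>G. open G \<longrightarrow>
        - (INF w\<in>G. I w)
          \<le> Liminf at_top (\<lambda>r. ereal (1 / v r) * log_prob (measure (M r) {\<omega> \<in> space (M r). W r \<omega> \<in> G})))"

definition good_rate_function :: "(real \<Rightarrow> ereal) \<Rightarrow> bool" where
  "good_rate_function I \<longleftrightarrow> (\<forall>\<eta>::real. 0 \<le> \<eta> \<longrightarrow> compact {w. I w \<le> ereal \<eta>})"

definition rate_J :: "real \<Rightarrow> real \<Rightarrow> real \<Rightarrow> ereal" where
  "rate_J \<mu> t b = (if b \<in> {0..t} then ereal (\<mu>\<^sup>2 / 2 * b) else \<infinity>)"

end

theory Submission
  imports Defs "HOL-Real_Asymp.Real_Asymp"
begin

text \<open>Write \<open>\<nu> = \<mu> sqrt r\<close> and \<open>X s = B s + \<nu> s\<close>. The explicit law of the last zero \<open>T\<close> of \<open>X\<close> in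
\<open>[0, t]\<close> is avoided. Everything rests on Doob's maximal inequality for the exponential
martingale \<open>exp (- \<nu> B s - \<nu>\<^sup>2 s / 2)\<close> (lemma \<open>exp_mart_exceed_le\<close>), applied from a positive
time \<open>a\<close> onwards and with an arbitrary initial weight that depends on \<open>B a\<close>.

For the upper bound (\<open>prob_last_zero_ge_le\<close>), if \<open>X s = 0\<close> then \<open>B s = - \<nu> s\<close> and the martingale
equals \<open>exp (\<nu>\<^sup>2 s / 2)\<close>. Hence \<open>T \<ge> b\<close> forces it above \<open>exp (\<nu>\<^sup>2 b / 2)\<close> at some time
after \<open>b\<close>, which has probability at most of order \<open>exp (- \<mu>\<^sup>2 r b / 2)\<close>.

For the lower bound (\<open>prob_last_zero_between_ge\<close>), let \<open>a < c < t\<close>. At time \<open>a\<close> the path \<open>X\<close> is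
slightly on the wrong side of the origin, as seen from the drift, with a probability that a
Gaussian density bounds below by \<open>exp (- \<mu>\<^sup>2 r a / 2)\<close> up to lower order terms in the exponent.
Given this, the drift carries the path across the origin before \<open>c\<close> and keeps it there until \<open>t\<close>
with conditional probability tending to one, again by the maximal inequality. Then
\<open>a \<le> T \<le> c\<close>, and \<open>a\<close> may be taken as close as desired to a given point of an open set.

The maximal inequality in continuous time comes from the one for products of independent
factors with mean one, by letting dyadic grids become finer along continuous paths.\<close>

section \<open>Maximal inequality for products of independent factors\<close>

text \<open>The sequence of partial products of \<open>y\<close>, frozen as soon as it has reached the level \<open>c\<close>.
Freezing turns the event that some partial product reaches \<open>c\<close> into an event about the last
value only, to which Markov's inequality applies.\<close>
primrec stopped_prod :: "real \<Rightarrow> (nat \<Rightarrow> real) \<Rightarrow> nat \<Rightarrow> real" where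
  "stopped_prod c y 0 = y 0"
| "stopped_prod c y (Suc k) =
    (if c \<le> stopped_prod c y k then stopped_prod c y k else stopped_prod c y k * y (Suc k))"

lemma stopped_prod_nonneg: "(\<And>i. i \<le> k \<Longrightarrow> 0 \<le> y i) \<Longrightarrow> 0 \<le> stopped_prod c y k"
  by (induction k) auto

lemma stopped_prod_cong: "(\<And>i. i \<le> k \<Longrightarrow> y i = z i) \<Longrightarrow> stopped_prod c y k = stopped_prod c z k"
  by (induction k) auto

lemma stopped_prod_eq_prod_or_ge:
  "(stopped_prod c y n = (\<Prod>i\<le>n. y i) \<and> (\<forall>k<n. (\<Prod>i\<le>k. y i) < c)) \<or> c \<le> stopped_prod c y n"
  by (induction n) (auto simp: less_Suc_eq)

lemma prod_ge_imp_stopped_prod_ge: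
  assumes "k \<le> n" "c \<le> (\<Prod>i\<le>k. y i)"
  shows "c \<le> stopped_prod c y n"
  using stopped_prod_eq_prod_or_ge[of c y n] assms by (metis le_neq_implies_less not_le)

text \<open>Independence of the stopped product and the next factor is obtained by composing independent
blocks of factors with measurable functions on product spaces, whence this form of measurability.
The index set \<open>I\<close> is general because it has to stay fixed during the induction on \<open>k\<close>.\<close>
lemma measurable_stopped_prod:
  "{..k} \<subseteq> I \<Longrightarrow> (\<lambda>y. stopped_prod c y k) \<in> borel_measurable (PiM I (\<lambda>_. borel))"
proof (induction k)
  case 0
  then show ?case by (simp add: measurable_component_singleton)
next
  case (Suc k)
  then have "{..k} \<subseteq> I" "Suc k \<in> I" by auto
  then have [measurable]: "(\<lambda>y. stopped_prod c y k) \<in> borel_measurable (PiM I (\<lambda>_. borel))"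
    "(\<lambda>y. y (Suc k)) \<in> borel_measurable (PiM I (\<lambda>_. borel :: real measure))"
    by (auto intro!: Suc.IH measurable_component_singleton)
  show ?case by simp
qed

context prob_space
begin

text \<open>Working with nonnegative integrals, which may be infinite, avoids all integrability conditions.
The pair is viewed as a family indexed by \<^typ>\<open>bool\<close>.\<close>
lemma nn_integral_mult_indep:
  fixes X Y :: "'a \<Rightarrow> real"
  assumes ind: "indep_var borel X borel Y" and X: "\<And>\<omega>. 0 \<le> X \<omega>" and Y: "\<And>\<omega>. 0 \<le> Y \<omega>"
  shows "(\<integral>\<^sup>+\<omega>. ennreal (X \<omega> * Y \<omega>) \<partial>M) = (\<integral>\<^sup>+\<omega>. ennreal (X \<omega>) \<partial>M) * (\<integral>\<^sup>+\<omega>. ennreal (Y \<omega>) \<partial>M)"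
proof -
  have "indep_vars (\<lambda>_. borel) (\<lambda>b. ennreal \<circ> (case b of True \<Rightarrow> X | False \<Rightarrow> Y)) UNIV"
  proof (rule indep_vars_compose)
    show "indep_vars (\<lambda>_. borel) (case_bool X Y) UNIV"
      using ind unfolding indep_var_def
      by (rule iffD1[OF indep_vars_cong, rotated -1]) (auto split: bool.split)
  qed auto
  from indep_vars_nn_integral[OF _ this]
  show ?thesis
    by (simp add: UNIV_bool ennreal_mult X Y mult.commute)
qed

lemma indep_stopped_prod:
  fixes Y :: "nat \<Rightarrow> 'a \<Rightarrow> real"
  assumes "indep_vars (\<lambda>_. borel) Y {..n}" "k < n"
  shows "indep_var borel (\<lambda>\<omega>. stopped_prod c (\<lambda>i. Y i \<omega>) k) borel (Y (Suc k))"
proof -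
  have "indep_var
    borel ((\<lambda>y. stopped_prod c y k) \<circ> (\<lambda>\<omega>. restrict (\<lambda>i. Y i \<omega>) {..k}))
    borel ((\<lambda>y. y (Suc k)) \<circ> (\<lambda>\<omega>. restrict (\<lambda>i. Y i \<omega>) {Suc k}))"
    using assms by (intro indep_var_compose[OF indep_var_restrict[OF assms(1)]] measurable_stopped_prod) auto
  also have "((\<lambda>y. stopped_prod c y k) \<circ> (\<lambda>\<omega>. restrict (\<lambda>i. Y i \<omega>) {..k})) = (\<lambda>\<omega>. stopped_prod c (\<lambda>i. Y i \<omega>) k)"
    by (auto simp: fun_eq_iff intro!: stopped_prod_cong)
  also have "((\<lambda>y. y (Suc k)) \<circ> (\<lambda>\<omega>. restrict (\<lambda>i. Y i \<omega>) {Suc k})) = Y (Suc k)"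
    by auto
  finally show ?thesis .
qed

text \<open>Optional stopping: as long as the product is below \<open>c\<close> it is multiplied by a factor of mean
one that is independent of the past, and otherwise it does not move. In either case the mean is
preserved.\<close>
lemma nn_integral_stopped_prod:
  fixes Y :: "nat \<Rightarrow> 'a \<Rightarrow> real"
  assumes ind: "indep_vars (\<lambda>_. borel) Y {..n}"
    and nonneg: "\<And>i \<omega>. 0 \<le> Y i \<omega>"
    and mean: "\<And>i. 0 < i \<Longrightarrow> i \<le> n \<Longrightarrow> (\<integral>\<^sup>+\<omega>. ennreal (Y i \<omega>) \<partial>M) = 1"
  shows "k \<le> n \<Longrightarrow> (\<integral>\<^sup>+\<omega>. ennreal (stopped_prod c (\<lambda>i. Y i \<omega>) k) \<partial>M) = (\<integral>\<^sup>+\<omega>. ennreal (Y 0 \<omega>) \<partial>M)"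
proof (induction k)
  case 0
  show ?case by simp
next
  case (Suc k)
  let ?V = "\<lambda>\<omega>. stopped_prod c (\<lambda>i. Y i \<omega>) k"
  have k: "k < n" using Suc.prems by simp
  have indV: "indep_var borel ?V borel (Y (Suc k))"
    by (rule indep_stopped_prod[OF ind k])
  have V0: "0 \<le> ?V \<omega>" for \<omega> by (rule stopped_prod_nonneg) (rule nonneg)
  have [measurable]: "?V \<in> borel_measurable M" "Y (Suc k) \<in> borel_measurable M"
    using indep_var_rv1[OF indV] indep_var_rv2[OF indV] by auto
  \<comment> \<open>The process splits into a part \<open>?U\<close> that still moves and a part \<open>?W\<close> that is frozen.\<close>
  let ?U = "\<lambda>\<omega>. (if c \<le> ?V \<omega> then 0 else ?V \<omega>)"
  let ?W = "\<lambda>\<omega>. (if c \<le> ?V \<omega> then ?V \<omega> else 0)"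
  have "indep_var borel ((\<lambda>v. if c \<le> v then 0 else v) \<circ> ?V) borel ((\<lambda>v. v) \<circ> Y (Suc k))"
    by (rule indep_var_compose[OF indV]) auto
  then have indU: "indep_var borel ?U borel (Y (Suc k))"
    by (simp add: comp_def)
  have "(\<integral>\<^sup>+\<omega>. ennreal (stopped_prod c (\<lambda>i. Y i \<omega>) (Suc k)) \<partial>M)
      = (\<integral>\<^sup>+\<omega>. ennreal (?W \<omega>) + ennreal (?U \<omega> * Y (Suc k) \<omega>) \<partial>M)"
    by (intro nn_integral_cong) auto
  also have "\<dots> = (\<integral>\<^sup>+\<omega>. ennreal (?W \<omega>) \<partial>M) + (\<integral>\<^sup>+\<omega>. ennreal (?U \<omega> * Y (Suc k) \<omega>) \<partial>M)"
    by (intro nn_integral_add) auto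
  also have "(\<integral>\<^sup>+\<omega>. ennreal (?U \<omega> * Y (Suc k) \<omega>) \<partial>M) = (\<integral>\<^sup>+\<omega>. ennreal (?U \<omega>) \<partial>M)"
    using mean[of "Suc k"] Suc.prems by (subst nn_integral_mult_indep[OF indU]) (auto simp: V0 nonneg)
  also have "(\<integral>\<^sup>+\<omega>. ennreal (?W \<omega>) \<partial>M) + (\<integral>\<^sup>+\<omega>. ennreal (?U \<omega>) \<partial>M) = (\<integral>\<^sup>+\<omega>. ennreal (?W \<omega>) + ennreal (?U \<omega>) \<partial>M)"
    by (intro nn_integral_add[symmetric]) auto
  also have "\<dots> = (\<integral>\<^sup>+\<omega>. ennreal (?V \<omega>) \<partial>M)"
    by (intro nn_integral_cong) auto
  also have "\<dots> = (\<integral>\<^sup>+\<omega>. ennreal (Y 0 \<omega>) \<partial>M)"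
    using Suc by simp
  finally show ?case .
qed

text \<open>Doob's inequality for a multiplicative martingale. The first factor has an
arbitrary mean because it serves as a random initial weight, which later is either a density or
the indicator of an initial event.\<close>
lemma maximal_inequality_prod:
  fixes Y :: "nat \<Rightarrow> 'a \<Rightarrow> real"
  assumes ind: "indep_vars (\<lambda>_. borel) Y {..n}"
    and nonneg: "\<And>i \<omega>. 0 \<le> Y i \<omega>"
    and mean: "\<And>i. 0 < i \<Longrightarrow> i \<le> n \<Longrightarrow> (\<integral>\<^sup>+\<omega>. ennreal (Y i \<omega>) \<partial>M) = 1"
    and c: "0 < c"
  shows "ennreal c * emeasure M {\<omega> \<in> space M. \<exists>k\<le>n. c \<le> (\<Prod>i\<le>k. Y i \<omega>)} \<le> (\<integral>\<^sup>+\<omega>. ennreal (Y 0 \<omega>) \<partial>M)"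
proof -
  let ?V = "\<lambda>\<omega>. stopped_prod c (\<lambda>i. Y i \<omega>) n"
  have V[measurable]: "?V \<in> borel_measurable M"
  proof -
    have Y: "Y i \<in> borel_measurable M" if "i \<le> n" for i
      using ind that by (auto simp: indep_vars_def)
    have "(\<lambda>y. stopped_prod c y n) \<circ> (\<lambda>\<omega>. restrict (\<lambda>i. Y i \<omega>) {..n}) \<in> borel_measurable M"
      using Y by (intro measurable_comp[OF measurable_restrict measurable_stopped_prod]) auto
    also have "(\<lambda>y. stopped_prod c y n) \<circ> (\<lambda>\<omega>. restrict (\<lambda>i. Y i \<omega>) {..n}) = ?V"
      by (auto simp: fun_eq_iff intro!: stopped_prod_cong)
    finally show ?thesis .
  qed
  have "ennreal c * emeasure M {\<omega> \<in> space M. \<exists>k\<le>n. c \<le> (\<Prod>i\<le>k. Y i \<omega>)}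
      \<le> ennreal c * emeasure M {\<omega> \<in> space M. c \<le> ?V \<omega>}"
    by (intro mult_left_mono emeasure_mono) (auto intro: prod_ge_imp_stopped_prod_ge)
  also have "\<dots> = (\<integral>\<^sup>+\<omega>. ennreal c * indicator {\<omega> \<in> space M. c \<le> ?V \<omega>} \<omega> \<partial>M)"
    by (subst nn_integral_cmult_indicator) auto
  also have "\<dots> \<le> (\<integral>\<^sup>+\<omega>. ennreal (?V \<omega>) \<partial>M)"
    by (intro nn_integral_mono) (auto split: split_indicator intro!: ennreal_leI)
  also have "\<dots> = (\<integral>\<^sup>+\<omega>. ennreal (Y 0 \<omega>) \<partial>M)"
    by (rule nn_integral_stopped_prod[OF ind nonneg mean]) auto
  finally show ?thesis .
qed

end

section \<open>Open events along dyadic times\<close>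

definition dyadic_point :: "real \<Rightarrow> real \<Rightarrow> nat \<Rightarrow> nat \<Rightarrow> real" where
  "dyadic_point a b j k = a + (b - a) * (real k / 2 ^ j)"

lemma dyadic_point_in: "a \<le> b \<Longrightarrow> k \<le> 2 ^ j \<Longrightarrow> dyadic_point a b j k \<in> {a..b}"
proof -
  assume "a \<le> b" "k \<le> 2 ^ j"
  then have "real k / 2 ^ j \<le> 1"
    by (simp add: divide_simps)
  then have "(b - a) * (real k / 2 ^ j) \<le> (b - a) * 1"
    using \<open>a \<le> b\<close> by (intro mult_left_mono) auto
  then show ?thesis using \<open>a \<le> b\<close> by (auto simp: dyadic_point_def)
qed

lemma dyadic_point_refine: "dyadic_point a b (Suc j) (2 * k) = dyadic_point a b j k"
  by (simp add: dyadic_point_def)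

text \<open>A path that enters an open set stays there for a while, hence is seen there at a dyadic time.
This replaces uncountable unions of events over all times by countable ones.\<close>
lemma ex_in_open_iff_ex_dyadic:
  fixes f :: "real \<Rightarrow> 'b :: topological_space"
  assumes ab: "a \<le> b" and f: "continuous_on {a..b} f" and U: "open U"
  shows "(\<exists>s\<in>{a..b}. f s \<in> U) \<longleftrightarrow> (\<exists>j k. k \<le> 2 ^ j \<and> f (dyadic_point a b j k) \<in> U)"
proof
  assume "\<exists>s\<in>{a..b}. f s \<in> U"
  then obtain s where s: "s \<in> {a..b}" "f s \<in> U" by auto
  define x where "x = (s - a) / (b - a)"
  have x: "0 \<le> x" "x \<le> 1" "s = a + (b - a) * x"
    using s(1) by (auto simp: x_def divide_simps)
  \<comment> \<open>Rounding the relative position \<open>x\<close> down to level \<open>j\<close> gives dyadic points that tend to \<open>s\<close>.\<close>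
  define k where "k j = nat \<lfloor>x * 2 ^ j\<rfloor>" for j
  have kle: "real (k j) \<le> x * 2 ^ j" and kgt: "x * 2 ^ j < real (k j) + 1" for j
    using x by (simp_all add: k_def)
  have k: "k j \<le> 2 ^ j" for j
  proof -
    have "real (k j) \<le> 1 * 2 ^ j"
      by (rule order_trans[OF kle]) (use x in auto)
    then show ?thesis by (metis mult_1 of_nat_le_iff of_nat_numeral of_nat_power)
  qed
  have "(\<lambda>j. real (k j) / 2 ^ j) \<longlonglongrightarrow> x"
  proof (rule tendsto_sandwich)
    show "\<forall>\<^sub>F j in sequentially. x - (1/2) ^ j \<le> real (k j) / 2 ^ j"
    proof (intro always_eventually allI)
      fix j show "x - (1/2) ^ j \<le> real (k j) / 2 ^ j"
        using divide_strict_right_mono[OF kgt[of j], of "2 ^ j"]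
        by (simp add: power_one_over add_divide_distrib)
    qed
    show "\<forall>\<^sub>F j in sequentially. real (k j) / 2 ^ j \<le> x"
      using kle by (intro always_eventually allI) (simp add: field_simps)
    have "(\<lambda>j. (1/2::real) ^ j) \<longlonglongrightarrow> 0"
      by (rule LIMSEQ_power_zero) simp
    from tendsto_diff[OF tendsto_const this, of x] show "(\<lambda>j. x - (1/2) ^ j) \<longlonglongrightarrow> x" by simp
  qed simp
  then have "(\<lambda>j. dyadic_point a b j (k j)) \<longlonglongrightarrow> s"
    unfolding dyadic_point_def x(3) by (intro tendsto_intros)
  then have "(\<lambda>j. f (dyadic_point a b j (k j))) \<longlonglongrightarrow> f s"
    using dyadic_point_in[OF ab k] s(1)
    by (intro continuous_on_tendsto_compose[OF f]) (auto intro: always_eventually)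
  then have "\<forall>\<^sub>F j in sequentially. f (dyadic_point a b j (k j)) \<in> U"
    using U s(2) by (rule topological_tendstoD)
  then obtain j where "f (dyadic_point a b j (k j)) \<in> U"
    using eventually_happens trivial_limit_sequentially by blast
  then show "\<exists>j k. k \<le> 2 ^ j \<and> f (dyadic_point a b j k) \<in> U" using k by blast
qed (use dyadic_point_in[OF ab] in blast)

section \<open>The exponential martingale of Brownian motion\<close>

text \<open>Completing the square: exponential tilting of a centred normal law only shifts its mean. In
particular the tilted density still has total mass one, which gives the next lemma.\<close>
lemma normal_density_exp_tilt:
  assumes "0 < \<sigma>"
  shows "normal_density 0 \<sigma> x * exp (l * x - l\<^sup>2 * \<sigma>\<^sup>2 / 2) = normal_density (l * \<sigma>\<^sup>2) \<sigma> x"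
  using assms unfolding normal_density_def
  by (simp add: exp_add[symmetric] power2_eq_square field_simps)

lemma nn_integral_exp_normal:
  assumes X: "distributed M lborel X (normal_density 0 \<sigma>)" and \<sigma>: "0 < \<sigma>"
  shows "(\<integral>\<^sup>+\<omega>. ennreal (exp (l * X \<omega> - l\<^sup>2 * \<sigma>\<^sup>2 / 2)) \<partial>M) = 1"
proof -
  have "(\<integral>\<^sup>+\<omega>. ennreal (exp (l * X \<omega> - l\<^sup>2 * \<sigma>\<^sup>2 / 2)) \<partial>M)
      = (\<integral>\<^sup>+x. ennreal (normal_density 0 \<sigma> x) * ennreal (exp (l * x - l\<^sup>2 * \<sigma>\<^sup>2 / 2)) \<partial>lborel)"
    by (rule distributed_nn_integral[OF X, symmetric]) auto
  also have "\<dots> = (\<integral>\<^sup>+x. ennreal (normal_density (l * \<sigma>\<^sup>2) \<sigma> x) \<partial>lborel)"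
    by (intro nn_integral_cong) (simp add: ennreal_mult[symmetric] normal_density_exp_tilt[OF \<sigma>])
  also have "\<dots> = 1"
    using \<sigma> by (simp add: nn_integral_eq_integral)
  finally show ?thesis .
qed

lemma standard_brownian_motionD:
  assumes "standard_brownian_motion M B"
  shows bm_prob_space: "prob_space M"
    and bm_measurable: "\<And>s. 0 \<le> s \<Longrightarrow> B s \<in> borel_measurable M"
    and bm_0: "\<And>\<omega>. \<omega> \<in> space M \<Longrightarrow> B 0 \<omega> = 0"
    and bm_continuous: "\<And>\<omega>. \<omega> \<in> space M \<Longrightarrow> continuous_on {0..} (\<lambda>s. B s \<omega>)"
    and bm_increment: "\<And>s u. 0 \<le> s \<Longrightarrow> s < u \<Longrightarrow>
      distributed M lborel (\<lambda>\<omega>. B u \<omega> - B s \<omega>) (normal_density 0 (sqrt (u - s)))"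
    and bm_indep: "\<And>(n::nat) \<tau>. 0 \<le> \<tau> 0 \<Longrightarrow> (\<And>i. i < n \<Longrightarrow> \<tau> i < \<tau> (Suc i)) \<Longrightarrow>
      prob_space.indep_vars M (\<lambda>_. borel) (\<lambda>i \<omega>. B (\<tau> (Suc i)) \<omega> - B (\<tau> i) \<omega>) {..<n}"
  using assms unfolding standard_brownian_motion_def by auto

text \<open>The density process of the drift \<open>l\<close>, restarted from value one at time \<open>a\<close>.\<close>
definition exp_mart :: "(real \<Rightarrow> 'a \<Rightarrow> real) \<Rightarrow> real \<Rightarrow> real \<Rightarrow> real \<Rightarrow> 'a \<Rightarrow> real" where
  "exp_mart B l a s \<omega> = exp (l * (B s \<omega> - B a \<omega>) - l\<^sup>2 * (s - a) / 2)"

lemma exp_mart_self [simp]: "exp_mart B l a a \<omega> = 1"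
  by (simp add: exp_mart_def)

lemma exp_mart_mult: "exp_mart B l a s \<omega> * exp_mart B l s u \<omega> = exp_mart B l a u \<omega>"
  by (simp add: exp_mart_def exp_add[symmetric] field_simps)

lemma nn_integral_exp_mart:
  assumes bm: "standard_brownian_motion M B" and "0 \<le> s" "s < u"
  shows "(\<integral>\<^sup>+\<omega>. ennreal (exp_mart B l s u \<omega>) \<partial>M) = 1"
  using nn_integral_exp_normal[OF bm_increment[OF bm assms(2,3)], of l] assms(3)
  by (simp add: exp_mart_def)

text \<open>On a grid starting at \<open>a\<close>, the increments of the path, preceded by the increment from time
\<open>0\<close> to time \<open>a\<close>, are independent. Hence the weight \<open>G (B a)\<close> and the successive ratios of the
exponential martingale are factors of the kind treated by the maximal inequality for products.\<close>
lemma exp_mart_maximal_dyadic: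
  assumes bm: "standard_brownian_motion M B" and a: "0 < a" "a < u"
    and G[measurable]: "G \<in> borel_measurable borel" and G0: "\<And>x. 0 \<le> G x" and c: "0 < c"
  shows "ennreal c * emeasure M {\<omega> \<in> space M. \<exists>k\<le>2^j. c \<le> G (B a \<omega>) * exp_mart B l a (dyadic_point a u j k) \<omega>}
    \<le> (\<integral>\<^sup>+\<omega>. ennreal (G (B a \<omega>)) \<partial>M)"
proof -
  interpret prob_space M by (rule bm_prob_space[OF bm])
  \<comment> \<open>Time \<open>0\<close> is put in front of the grid, so that \<open>B a\<close> is itself one of the increments \<open>D\<close>.\<close>
  define \<tau> where "\<tau> i = (case i of 0 \<Rightarrow> 0 | Suc k \<Rightarrow> dyadic_point a u j k)" for i
  define D where "D i \<omega> = B (\<tau> (Suc i)) \<omega> - B (\<tau> i) \<omega>" for i \<omega>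
  have \<tau>0: "\<tau> 0 = 0" and \<tau>1: "\<tau> (Suc 0) = a" and \<tau>S: "\<tau> (Suc k) = dyadic_point a u j k" for k
    by (simp_all add: \<tau>_def dyadic_point_def)
  have mono: "\<tau> i < \<tau> (Suc i)" for i
    using a by (cases i) (auto simp: \<tau>_def dyadic_point_def divide_strict_right_mono)
  have pos: "0 \<le> \<tau> i" for i
    using a by (cases i) (auto simp: \<tau>_def dyadic_point_def)
  define Y where "Y i \<omega> = (if i = 0 then G (D 0 \<omega>)
      else exp (l * D i \<omega> - l\<^sup>2 * (\<tau> (Suc i) - \<tau> i) / 2))" for i \<omega>
  have "indep_vars (\<lambda>_. borel) D {..<Suc (2 ^ j)}"
    unfolding D_def[abs_def] by (rule bm_indep[OF bm]) (auto simp: \<tau>0 mono)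
  then have "indep_vars (\<lambda>_. borel) (\<lambda>i \<omega>. (if i = 0 then G else (\<lambda>x. exp (l * x - l\<^sup>2 * (\<tau> (Suc i) - \<tau> i) / 2))) (D i \<omega>)) {..<Suc (2 ^ j)}"
    by (rule indep_vars_compose2) auto
  also have "(\<lambda>i \<omega>. (if i = 0 then G else (\<lambda>x. exp (l * x - l\<^sup>2 * (\<tau> (Suc i) - \<tau> i) / 2))) (D i \<omega>)) = Y"
    by (auto simp: fun_eq_iff Y_def)
  finally have ind: "indep_vars (\<lambda>_. borel) Y {..2 ^ j}"
    by (simp only: lessThan_Suc_atMost)
  have mean: "(\<integral>\<^sup>+\<omega>. ennreal (Y i \<omega>) \<partial>M) = 1" if "0 < i" for i
    using nn_integral_exp_mart[OF bm pos mono, of l i] that by (simp add: Y_def D_def exp_mart_def)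
  have Y0: "Y 0 \<omega> = G (B a \<omega>)" if "\<omega> \<in> space M" for \<omega>
    using bm_0[OF bm that] by (simp add: Y_def D_def \<tau>0 \<tau>1)
  have prod: "(\<Prod>i\<le>k. Y i \<omega>) = G (B a \<omega>) * exp_mart B l a (\<tau> (Suc k)) \<omega>" if "\<omega> \<in> space M" for k \<omega>
  proof (induction k)
    case 0
    show ?case using Y0[OF that] by (simp add: \<tau>1)
  next
    case (Suc k)
    have "Y (Suc k) \<omega> = exp_mart B l (\<tau> (Suc k)) (\<tau> (Suc (Suc k))) \<omega>"
      by (simp add: Y_def D_def exp_mart_def)
    then show ?case using Suc by (simp add: exp_mart_mult mult.assoc)
  qed
  have "ennreal c * emeasure M {\<omega> \<in> space M. \<exists>k\<le>2^j. c \<le> (\<Prod>i\<le>k. Y i \<omega>)} \<le> (\<integral>\<^sup>+\<omega>. ennreal (Y 0 \<omega>) \<partial>M)"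
    by (rule maximal_inequality_prod[OF ind _ mean c]) (auto simp: Y_def G0)
  also have "{\<omega> \<in> space M. \<exists>k\<le>2^j. c \<le> (\<Prod>i\<le>k. Y i \<omega>)}
      = {\<omega> \<in> space M. \<exists>k\<le>2^j. c \<le> G (B a \<omega>) * exp_mart B l a (dyadic_point a u j k) \<omega>}"
    by (auto simp: prod \<tau>S)
  also have "(\<integral>\<^sup>+\<omega>. ennreal (Y 0 \<omega>) \<partial>M) = (\<integral>\<^sup>+\<omega>. ennreal (G (B a \<omega>)) \<partial>M)"
    by (intro nn_integral_cong) (simp add: Y0)
  finally show ?thesis .
qed

text \<open>The level is exceeded strictly here: only then is the event in continuous time the increasing
union of its versions on the dyadic grids.\<close>
lemma exp_mart_maximal:
  fixes l :: real
  assumes bm: "standard_brownian_motion M B" and a: "0 < a" "a < u"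
    and G[measurable]: "G \<in> borel_measurable borel" and G0: "\<And>x. 0 \<le> G x" and c: "0 < c"
  defines "E \<equiv> {\<omega> \<in> space M. \<exists>s\<in>{a..u}. c < G (B a \<omega>) * exp_mart B l a s \<omega>}"
  shows exp_mart_exceed_sets: "E \<in> sets M"
    and exp_mart_exceed_le: "ennreal c * emeasure M E \<le> (\<integral>\<^sup>+\<omega>. ennreal (G (B a \<omega>)) \<partial>M)"
proof -
  define A where "A j = {\<omega> \<in> space M. \<exists>k\<le>2^j. c < G (B a \<omega>) * exp_mart B l a (dyadic_point a u j k) \<omega>}" for j
  have [measurable]: "B a \<in> borel_measurable M"
    using bm_measurable[OF bm] a by simp
  have [measurable]: "exp_mart B l a (dyadic_point a u j k) \<in> borel_measurable M" for j k
  proof -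
    have [measurable]: "B (dyadic_point a u j k) \<in> borel_measurable M"
      using bm_measurable[OF bm] a by (simp add: dyadic_point_def)
    show ?thesis unfolding exp_mart_def[abs_def] by measurable
  qed
  have A[measurable]: "A j \<in> sets M" for j
    unfolding A_def by measurable
  have cont: "continuous_on {a..u} (\<lambda>s. G (B a \<omega>) * exp_mart B l a s \<omega>)" if "\<omega> \<in> space M" for \<omega>
    unfolding exp_mart_def using a
    by (intro continuous_intros continuous_on_subset[OF bm_continuous[OF bm that]]) auto
  have E: "E = (\<Union>j. A j)"
  proof -
    have "(\<exists>s\<in>{a..u}. c < G (B a \<omega>) * exp_mart B l a s \<omega>)
        \<longleftrightarrow> (\<exists>j k. k \<le> 2^j \<and> c < G (B a \<omega>) * exp_mart B l a (dyadic_point a u j k) \<omega>)"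
      if "\<omega> \<in> space M" for \<omega>
      using ex_in_open_iff_ex_dyadic[OF _ cont[OF that] open_greaterThan[of c]] a by simp
    then have "E = {\<omega> \<in> space M. \<exists>j k. k \<le> 2^j \<and> c < G (B a \<omega>) * exp_mart B l a (dyadic_point a u j k) \<omega>}"
      unfolding E_def by (intro Collect_cong conj_cong refl)
    then show ?thesis by (auto simp: A_def)
  qed
  then show "E \<in> sets M" by simp
  have "A j \<subseteq> A (Suc j)" for j
  proof
    fix \<omega> assume "\<omega> \<in> A j"
    then obtain k where "\<omega> \<in> space M" "k \<le> 2^j" "c < G (B a \<omega>) * exp_mart B l a (dyadic_point a u (Suc j) (2 * k)) \<omega>"
      by (auto simp: A_def dyadic_point_refine)
    then show "\<omega> \<in> A (Suc j)" by (auto simp: A_def intro!: exI[of _ "2 * k"])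
  qed
  then have "incseq A" by (rule incseq_SucI)
  then have "emeasure M E = (SUP j. emeasure M (A j))"
    unfolding E by (intro SUP_emeasure_incseq[symmetric]) auto
  then have "ennreal c * emeasure M E = (SUP j. ennreal c * emeasure M (A j))"
    by (simp add: SUP_mult_left_ennreal)
  also have "\<dots> \<le> (\<integral>\<^sup>+\<omega>. ennreal (G (B a \<omega>)) \<partial>M)"
  proof (rule SUP_least)
    fix j
    have "ennreal c * emeasure M (A j) \<le> ennreal c *
      emeasure M {\<omega> \<in> space M. \<exists>k\<le>2^j. c \<le> G (B a \<omega>) * exp_mart B l a (dyadic_point a u j k) \<omega>}"
      by (intro mult_left_mono emeasure_mono) (auto simp: A_def less_imp_le)
    also have "\<dots> \<le> (\<integral>\<^sup>+\<omega>. ennreal (G (B a \<omega>)) \<partial>M)"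
      by (rule exp_mart_maximal_dyadic[OF bm a G G0 c])
    finally show "ennreal c * emeasure M (A j) \<le> (\<integral>\<^sup>+\<omega>. ennreal (G (B a \<omega>)) \<partial>M)" .
  qed
  finally show "ennreal c * emeasure M E \<le> (\<integral>\<^sup>+\<omega>. ennreal (G (B a \<omega>)) \<partial>M)" .
qed

lemma (in finite_measure) measure_le_divide:
  assumes "ennreal c * emeasure M S \<le> ennreal q" "0 < c" "0 \<le> q"
  shows "measure M S \<le> q / c"
  using assms by (simp add: emeasure_eq_measure ennreal_mult[symmetric] field_simps)

lemma drifted_continuous:
  assumes "standard_brownian_motion M B" "\<omega> \<in> space M"
  shows "continuous_on {0..} (\<lambda>s. drifted B \<nu> s \<omega>)"
  unfolding drifted_def by (intro continuous_intros bm_continuous[OF assms])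

section \<open>The last zero as a random variable\<close>

text \<open>The zeros of a continuous path form a closed set, which therefore contains its supremum.\<close>
lemma last_zero_is_zero:
  assumes X: "continuous_on {0..t} (\<lambda>s. X s \<omega>)" "X 0 \<omega> = 0" and t: "0 \<le> t"
  shows "last_zero X t \<omega> \<in> {0..t} \<and> X (last_zero X t \<omega>) \<omega> = 0"
proof -
  let ?Z = "{s \<in> {0..t}. X s \<omega> = 0}"
  have "closed ?Z"
    using continuous_closed_preimage_constant[OF X(1)] by simp
  moreover have "?Z \<noteq> {}" using X t by auto
  moreover have "bdd_above ?Z" by (rule bdd_aboveI[of _ t]) auto
  ultimately have "Sup ?Z \<in> ?Z" by (intro closed_contains_Sup)
  then show ?thesis by (simp add: last_zero_def)
qed

lemma le_last_zero:
  assumes "s \<in> {0..t}" "X s \<omega> = 0"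
  shows "s \<le> last_zero X t \<omega>"
  unfolding last_zero_def using assms by (intro cSup_upper bdd_aboveI[of _ t]) auto

lemma last_zero_ge_iff:
  assumes X: "continuous_on {0..t} (\<lambda>s. X s \<omega>)" "X 0 \<omega> = 0" and t: "0 \<le> t" and b: "0 \<le> b"
  shows "b \<le> last_zero X t \<omega> \<longleftrightarrow> (\<exists>s\<in>{b..t}. X s \<omega> = 0)"
proof
  assume "b \<le> last_zero X t \<omega>"
  then show "\<exists>s\<in>{b..t}. X s \<omega> = 0"
    using last_zero_is_zero[where X = X, OF X t] by (intro bexI[of _ "last_zero X t \<omega>"]) auto
next
  assume "\<exists>s\<in>{b..t}. X s \<omega> = 0"
  then obtain s where "b \<le> s" "s \<le> t" "X s \<omega> = 0" by auto
  then show "b \<le> last_zero X t \<omega>"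
    using le_last_zero[of s t X \<omega>] b by simp
qed

text \<open>Having a zero is a closed condition, so dyadic times do not detect it directly. By compactness
it is the countable intersection of the open conditions of getting close to zero.\<close>
lemma ex_zero_iff_ex_small_dyadic:
  fixes f :: "real \<Rightarrow> real"
  assumes ab: "a \<le> b" and f: "continuous_on {a..b} f"
  shows "(\<exists>s\<in>{a..b}. f s = 0) \<longleftrightarrow> (\<forall>n. \<exists>j k. k \<le> 2 ^ j \<and> \<bar>f (dyadic_point a b j k)\<bar> < 1 / real (Suc n))"
proof -
  have fa: "continuous_on {a..b} (\<lambda>s. \<bar>f s\<bar>)" using f by (intro continuous_intros)
  have "(\<exists>s\<in>{a..b}. f s = 0) \<longleftrightarrow> (\<forall>n. \<exists>s\<in>{a..b}. \<bar>f s\<bar> < 1 / real (Suc n))"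
  proof
    assume *: "\<forall>n. \<exists>s\<in>{a..b}. \<bar>f s\<bar> < 1 / real (Suc n)"
    obtain m where m: "m \<in> {a..b}" "\<And>s. s \<in> {a..b} \<Longrightarrow> \<bar>f m\<bar> \<le> \<bar>f s\<bar>"
      using continuous_attains_inf[OF _ _ fa] ab by auto
    have "f m = 0"
    proof (rule ccontr)
      assume "f m \<noteq> 0"
      then obtain n where "1 / real (Suc n) < \<bar>f m\<bar>"
        using nat_approx_posE[of "\<bar>f m\<bar>"] by (auto simp: zero_less_abs_iff)
      moreover obtain s where "s \<in> {a..b}" "\<bar>f s\<bar> < 1 / real (Suc n)" using * by blast
      ultimately show False using m(2)[of s] by linarith
    qed
    with m(1) show "\<exists>s\<in>{a..b}. f s = 0" by blast
  qed (auto intro!: bexI)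
  also have "\<dots> \<longleftrightarrow> (\<forall>n. \<exists>j k. k \<le> 2 ^ j \<and> \<bar>f (dyadic_point a b j k)\<bar> < 1 / real (Suc n))"
    using ex_in_open_iff_ex_dyadic[OF ab fa open_lessThan] by simp
  finally show ?thesis .
qed

lemma last_zero_measurable:
  assumes bm: "standard_brownian_motion M B" and t: "0 \<le> t"
  shows "last_zero (drifted B \<nu>) t \<in> borel_measurable M"
proof (rule borel_measurableI_ge)
  fix b
  have cont: "continuous_on {0..t} (\<lambda>s. drifted B \<nu> s \<omega>)" if "\<omega> \<in> space M" for \<omega>
    by (rule continuous_on_subset[OF drifted_continuous[OF bm that]]) auto
  have X0: "drifted B \<nu> 0 \<omega> = 0" if "\<omega> \<in> space M" for \<omega>
    using bm_0[OF bm that] by (simp add: drifted_def)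
  note mem = last_zero_is_zero[where X = "drifted B \<nu>", OF cont X0 t]
  consider "b \<le> 0" | "t < b" | "0 \<le> b" "b \<le> t" by linarith
  then show "{\<omega> \<in> space M. b \<le> last_zero (drifted B \<nu>) t \<omega>} \<in> sets M"
  proof cases
    case 1
    then have "{\<omega> \<in> space M. b \<le> last_zero (drifted B \<nu>) t \<omega>} = space M"
      using mem by fastforce
    then show ?thesis by simp
  next
    case 2
    then have "{\<omega> \<in> space M. b \<le> last_zero (drifted B \<nu>) t \<omega>} = {}"
      using mem by fastforce
    then show ?thesis by (metis sets.empty_sets)
  next
    case 3
    have [measurable]: "drifted B \<nu> (dyadic_point b t j k) \<in> borel_measurable M" for j k
    proof -
      have [measurable]: "B (dyadic_point b t j k) \<in> borel_measurable M"
        using bm_measurable[OF bm] 3 by (simp add: dyadic_point_def)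
      show ?thesis unfolding drifted_def[abs_def] by measurable
    qed
    have "b \<le> last_zero (drifted B \<nu>) t \<omega> \<longleftrightarrow>
        (\<forall>n. \<exists>j k. k \<le> 2 ^ j \<and> \<bar>drifted B \<nu> (dyadic_point b t j k) \<omega>\<bar> < 1 / real (Suc n))"
      if "\<omega> \<in> space M" for \<omega>
      unfolding last_zero_ge_iff[where X = "drifted B \<nu>", OF cont[OF that] X0[OF that] t 3(1)]
      by (rule ex_zero_iff_ex_small_dyadic[OF 3(2)])
        (rule continuous_on_subset[OF cont[OF that]], use 3 in auto)
    then have "{\<omega> \<in> space M. b \<le> last_zero (drifted B \<nu>) t \<omega>} = {\<omega> \<in> space M.
        \<forall>n. \<exists>j k. k \<le> 2 ^ j \<and> \<bar>drifted B \<nu> (dyadic_point b t j k) \<omega>\<bar> < 1 / real (Suc n)}"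
      by auto
    also have "\<dots> \<in> sets M" by measurable
    finally show ?thesis .
  qed
qed

section \<open>Exponential bounds for the last zero\<close>

text \<open>At a zero \<open>s \<ge> b\<close> of the drifted path one has \<open>B s = - \<nu> s\<close>, so the exponential martingale with
parameter \<open>- \<nu>\<close> has the value \<open>exp (\<nu>\<^sup>2 s / 2) \<ge> exp (\<nu>\<^sup>2 b / 2)\<close> there, which the maximal
inequality makes unlikely. The factor \<open>2\<close> pays for the strict inequality in the exceeded level
and disappears on the exponential scale.\<close>
lemma prob_last_zero_ge_le:
  assumes bm: "standard_brownian_motion M B" and t: "0 \<le> t" and b: "0 < b"
  shows "measure M {\<omega> \<in> space M. b \<le> last_zero (drifted B \<nu>) t \<omega>} \<le> 2 * exp (- (\<nu>\<^sup>2 * b / 2))"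
proof -
  interpret prob_space M by (rule bm_prob_space[OF bm])
  define G where "G x = exp (- \<nu> * x - \<nu>\<^sup>2 * b / 2)" for x
  define c where "c = exp (\<nu>\<^sup>2 * b / 2) / 2"
  \<comment> \<open>Any horizon beyond both \<open>b\<close> and \<open>t\<close> works; this one also covers \<open>b \<ge> t\<close>.\<close>
  define u where "u = b + t + 1"
  define E where "E = {\<omega> \<in> space M. \<exists>s\<in>{b..u}. c < G (B b \<omega>) * exp_mart B (- \<nu>) b s \<omega>}"
  have c: "0 < c" by (simp add: c_def)
  have bu: "b < u" using t by (simp add: u_def)
  have G: "G \<in> borel_measurable borel" "\<And>x. 0 \<le> G x" by (simp_all add: G_def[abs_def])
  note max = exp_mart_maximal[OF bm b bu G c, of "- \<nu>", folded E_def]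
  have "(\<integral>\<^sup>+\<omega>. ennreal (G (B b \<omega>)) \<partial>M) = (\<integral>\<^sup>+\<omega>. ennreal (exp_mart B (- \<nu>) 0 b \<omega>) \<partial>M)"
    by (intro nn_integral_cong) (simp add: G_def exp_mart_def bm_0[OF bm])
  also have "\<dots> = 1" by (rule nn_integral_exp_mart[OF bm]) (use b in auto)
  finally have "measure M E \<le> 1 / c"
    using max(2) c by (intro measure_le_divide) auto
  moreover have "{\<omega> \<in> space M. b \<le> last_zero (drifted B \<nu>) t \<omega>} \<subseteq> E"
  proof safe
    fix \<omega> assume \<omega>: "\<omega> \<in> space M" and ge: "b \<le> last_zero (drifted B \<nu>) t \<omega>"
    have "continuous_on {0..t} (\<lambda>s. drifted B \<nu> s \<omega>)"
      by (rule continuous_on_subset[OF drifted_continuous[OF bm \<omega>]]) auto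
    moreover have "drifted B \<nu> 0 \<omega> = 0" using bm_0[OF bm \<omega>] by (simp add: drifted_def)
    ultimately obtain s where s: "b \<le> s" "s \<le> t" "drifted B \<nu> s \<omega> = 0"
      using last_zero_ge_iff[where X = "drifted B \<nu>"] t b ge by (metis atLeastAtMost_iff less_imp_le)
    have Bs: "B s \<omega> = - \<nu> * s" using s(3) by (simp add: drifted_def)
    have "G (B b \<omega>) * exp_mart B (- \<nu>) b s \<omega> = exp (\<nu>\<^sup>2 * s / 2)"
      by (simp add: G_def exp_mart_def Bs exp_add[symmetric] power2_eq_square field_simps)
    moreover have "exp (\<nu>\<^sup>2 * b / 2) \<le> exp (\<nu>\<^sup>2 * s / 2)"
      using s(1) by (simp add: mult_left_mono)
    moreover have "c < exp (\<nu>\<^sup>2 * b / 2)" by (simp add: c_def)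
    ultimately have "c < G (B b \<omega>) * exp_mart B (- \<nu>) b s \<omega>" by linarith
    then show "\<omega> \<in> E" using \<omega> s b by (auto simp: E_def u_def intro!: bexI[of _ s])
  qed
  then have "measure M {\<omega> \<in> space M. b \<le> last_zero (drifted B \<nu>) t \<omega>} \<le> measure M E"
    by (rule finite_measure_mono) (rule max(1))
  moreover have "1 / c = 2 * exp (- (\<nu>\<^sup>2 * b / 2))"
    by (simp add: c_def exp_minus field_simps)
  ultimately show ?thesis by linarith
qed

text \<open>The centred Gaussian density decreases with the distance from the origin, so on an interval of
length one it integrates to at least its value at a point farther out than the whole interval.\<close>
lemma prob_unit_interval_ge:
  assumes bm: "standard_brownian_motion M B" and a: "0 < a"
    and I: "\<And>x. x \<in> {z..z + 1} \<Longrightarrow> \<bar>x\<bar> \<le> y"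
  shows "normal_density 0 (sqrt a) y \<le> measure M {\<omega> \<in> space M. B a \<omega> \<in> {z..z + 1}}"
proof -
  interpret prob_space M by (rule bm_prob_space[OF bm])
  have dist: "distributed M lborel (\<lambda>\<omega>. B a \<omega> - B 0 \<omega>) (normal_density 0 (sqrt (a - 0)))"
    by (rule bm_increment[OF bm]) (use a in auto)
  have "normal_density 0 (sqrt a) y \<le> normal_density 0 (sqrt a) x" if "x \<in> {z..z+1}" for x
  proof -
    have "x\<^sup>2 \<le> y\<^sup>2" using power_mono[OF I[OF that], of 2] by simp
    then show ?thesis using a
      by (simp add: normal_density_def divide_right_mono mult_left_mono divide_left_mono)
  qed
  then have "(\<integral>\<^sup>+x. ennreal (normal_density 0 (sqrt a) y) * indicator {z..z+1} x \<partial>lborel)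
      \<le> (\<integral>\<^sup>+x. ennreal (normal_density 0 (sqrt a) x) * indicator {z..z+1} x \<partial>lborel)"
    by (intro nn_integral_mono) (auto split: split_indicator intro!: ennreal_leI)
  also have "\<dots> = emeasure M ((\<lambda>\<omega>. B a \<omega> - B 0 \<omega>) -` {z..z+1} \<inter> space M)"
    using distributed_emeasure[OF dist, of "{z..z+1}"] by simp
  also have "(\<lambda>\<omega>. B a \<omega> - B 0 \<omega>) -` {z..z+1} \<inter> space M = {\<omega> \<in> space M. B a \<omega> \<in> {z..z + 1}}"
    using bm_0[OF bm] by auto
  finally show ?thesis
    by (simp add: nn_integral_cmult_indicator emeasure_eq_measure)
qed

text \<open>Suppose that at time \<open>a\<close> the drifted path is within distance one of the origin, on the side
opposite to the drift. This costs the Gaussian density factor. From there on the path follows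
the drift, and if \<open>\<nu>\<^sup>2\<close> is large it is on the other side during all of \<open>[c, t]\<close>, except with
small conditional probability; then it has a zero in \<open>[a, c]\<close> and none later. The exceptional
event is controlled by the maximal inequality, with the indicator of the event at time \<open>a\<close> as
initial weight, so that the bound is relative to the probability of that event.\<close>
lemma prob_last_zero_between_ge:
  assumes bm: "standard_brownian_motion M B" and ac: "0 < a" "a < c" "c < t"
  shows "normal_density 0 (sqrt a) (\<bar>\<nu>\<bar> * a + 1) * (1 - 2 * exp (\<bar>\<nu>\<bar> - \<nu>\<^sup>2 * (c - a) / 2))
    \<le> measure M {\<omega> \<in> space M. last_zero (drifted B \<nu>) t \<omega> \<in> {a..c}}"
    (is "?d * (1 - 2 * ?e) \<le> measure M ?T")
proof -
  interpret prob_space M by (rule bm_prob_space[OF bm])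
  \<comment> \<open>A unit interval of values of \<open>B a\<close> for which \<open>B a + \<nu> a\<close> is opposite in sign to \<open>\<nu>\<close>.\<close>
  define z where "z = (if 0 \<le> \<nu> then - \<nu> * a - 1 else - \<nu> * a)"
  define I where "I = {z..z + 1}"
  define S where "S = {\<omega> \<in> space M. B a \<omega> \<in> I}"
  \<comment> \<open>Half of the value which the exponential martingale must reach for a late return.\<close>
  define h where "h = 1 / (2 * ?e)"
  define E where "E = {\<omega> \<in> space M. \<exists>s\<in>{a..t}. h < indicator I (B a \<omega>) * exp_mart B (- \<nu>) a s \<omega>}"
  have h: "0 < h" by (simp add: h_def)
  have [measurable]: "B a \<in> borel_measurable M" using bm_measurable[OF bm] ac by simp
  have S[measurable]: "S \<in> sets M" unfolding S_def I_def by measurable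
  have [measurable]: "last_zero (drifted B \<nu>) t \<in> borel_measurable M"
    using last_zero_measurable[OF bm, of t \<nu>] ac by simp
  have T[measurable]: "?T \<in> sets M" by measurable
  have at: "a < t" using ac by simp
  have G: "(indicator I :: real \<Rightarrow> real) \<in> borel_measurable borel" "\<And>x. 0 \<le> (indicator I x :: real)"
    by (simp_all add: I_def)
  note max = exp_mart_maximal[OF bm ac(1) at G h, of "- \<nu>", folded E_def]
  have "(\<integral>\<^sup>+\<omega>. ennreal (indicator I (B a \<omega>)) \<partial>M) = (\<integral>\<^sup>+\<omega>. indicator S \<omega> \<partial>M)"
    by (intro nn_integral_cong) (auto simp: S_def split: split_indicator)
  also have "\<dots> = ennreal (measure M S)" by (simp add: emeasure_eq_measure)
  finally have "measure M E \<le> measure M S / h"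
    using max(2) h by (intro measure_le_divide) auto
  then have E: "measure M E \<le> measure M S * (2 * ?e)" by (simp add: h_def)
  have sub: "S - E \<subseteq> ?T"
  proof
    fix \<omega> assume "\<omega> \<in> S - E"
    then have \<omega>: "\<omega> \<in> space M" and Ba: "B a \<omega> \<in> I"
      and small: "\<And>s. s \<in> {a..t} \<Longrightarrow> exp_mart B (- \<nu>) a s \<omega> \<le> h"
      by (auto simp: S_def E_def not_less)
    let ?X = "\<lambda>s. drifted B \<nu> s \<omega>"
    have Xa: "- \<bar>\<nu>\<bar> \<le> \<nu> * ?X a" "\<nu> * ?X a \<le> 0"
    proof -
      have "0 \<le> \<nu> \<Longrightarrow> - 1 \<le> ?X a \<and> ?X a \<le> 0" "\<not> 0 \<le> \<nu> \<Longrightarrow> 0 \<le> ?X a \<and> ?X a \<le> 1"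
        using Ba by (auto simp: I_def z_def drifted_def)
      then show "- \<bar>\<nu>\<bar> \<le> \<nu> * ?X a" "\<nu> * ?X a \<le> 0"
        using mult_left_mono[of "-1" "?X a" \<nu>] mult_left_mono_neg[of "?X a" 1 \<nu>]
        by (cases "0 \<le> \<nu>"; auto simp: mult_nonneg_nonpos mult_nonpos_nonneg)+
    qed
    have pos: "0 < \<nu> * ?X s" if s: "s \<in> {c..t}" for s
    proof (rule ccontr)
      assume "\<not> 0 < \<nu> * ?X s"
      then have "- \<bar>\<nu>\<bar> + \<nu>\<^sup>2 * (s - a) / 2 \<le> - \<nu> * (B s \<omega> - B a \<omega>) - \<nu>\<^sup>2 * (s - a) / 2"
        using Xa(1) by (simp add: drifted_def power2_eq_square field_simps)
      moreover have "\<nu>\<^sup>2 * (c - a) / 2 \<le> \<nu>\<^sup>2 * (s - a) / 2"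
        using s by (simp add: mult_left_mono)
      ultimately have "exp (- (\<bar>\<nu>\<bar> - \<nu>\<^sup>2 * (c - a) / 2)) \<le> exp_mart B (- \<nu>) a s \<omega>"
        unfolding exp_mart_def by simp
      also have "\<dots> \<le> h" using s ac by (intro small) auto
      also have "h < exp (- (\<bar>\<nu>\<bar> - \<nu>\<^sup>2 * (c - a) / 2))"
        unfolding exp_minus[of "\<bar>\<nu>\<bar> - \<nu>\<^sup>2 * (c - a) / 2"] by (simp add: h_def field_simps)
      finally show False by simp
    qed
    have cont: "continuous_on {0..} ?X" by (rule drifted_continuous[OF bm \<omega>])
    have X0: "?X 0 = 0" using bm_0[OF bm \<omega>] by (simp add: drifted_def)
    have \<nu>: "\<nu> \<noteq> 0" using pos[of c] ac by auto
    have "\<exists>s\<ge>a. s \<le> c \<and> \<nu> * ?X s = 0"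
      using Xa(2) pos[of c] ac
      by (intro IVT' continuous_intros continuous_on_subset[OF cont]) auto
    then obtain s where s: "a \<le> s" "s \<le> c" "?X s = 0" using \<nu> by auto
    then have "a \<le> last_zero (drifted B \<nu>) t \<omega>"
      using le_last_zero[of s t "drifted B \<nu>" \<omega>] ac by auto
    moreover have "last_zero (drifted B \<nu>) t \<omega> \<in> {0..t} \<and> ?X (last_zero (drifted B \<nu>) t \<omega>) = 0"
      using ac X0 by (intro last_zero_is_zero continuous_on_subset[OF cont]) auto
    ultimately show "\<omega> \<in> ?T"
      using pos[of "last_zero (drifted B \<nu>) t \<omega>"] \<omega> by force
  qed
  have "measure M S \<le> measure M (?T \<union> E)"
    using sub max(1) by (intro finite_measure_mono) auto
  also have "\<dots> \<le> measure M ?T + measure M E"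
    using max(1) by (intro measure_Un_le) auto
  finally have "measure M S * (1 - 2 * ?e) \<le> measure M ?T"
    using E by (simp add: algebra_simps)
  show ?thesis
  proof (cases "0 \<le> 1 - 2 * ?e")
    case True
    have "?d \<le> measure M S"
      unfolding S_def I_def
    proof (rule prob_unit_interval_ge[OF bm ac(1)])
      fix x assume x: "x \<in> {z..z + 1}"
      show "\<bar>x\<bar> \<le> \<bar>\<nu>\<bar> * a + 1"
      proof (cases "0 \<le> \<nu>")
        case True
        then have "0 \<le> \<nu> * a" using ac(1) by simp
        moreover have "- (\<nu> * a) - 1 \<le> x" "x \<le> - (\<nu> * a)" using x True by (simp_all add: z_def)
        ultimately have "\<bar>x\<bar> \<le> \<nu> * a + 1" by linarith
        then show ?thesis using True by simp
      next
        case False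
        then have "\<nu> * a \<le> 0" using ac(1) by (simp add: mult_nonpos_nonneg)
        moreover have "- (\<nu> * a) \<le> x" "x \<le> - (\<nu> * a) + 1" using x False by (simp_all add: z_def)
        ultimately have "\<bar>x\<bar> \<le> - (\<nu> * a) + 1" by linarith
        then show ?thesis using False by simp
      qed
    qed
    then have "?d * (1 - 2 * ?e) \<le> measure M S * (1 - 2 * ?e)"
      using True by (rule mult_right_mono)
    then show ?thesis using \<open>measure M S * (1 - 2 * ?e) \<le> measure M ?T\<close> by linarith
  next
    case False
    then have "?d * (1 - 2 * ?e) \<le> 0" by (intro mult_nonneg_nonpos) auto
    then show ?thesis using measure_nonneg[of M ?T] by linarith
  qed
qed

section \<open>The exponential scale and the rate function\<close>

text \<open>The upper bounds are compared with a positive function \<open>q\<close>, so that the real logarithm of \<open>q\<close>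
can be used even when \<open>p\<close> vanishes and its extended logarithm is \<open>- \<infinity>\<close>.\<close>
lemma Limsup_log_prob_le:
  assumes p: "\<forall>\<^sub>F r in at_top. 0 \<le> p r \<and> p r \<le> q r" and q: "\<forall>\<^sub>F r in at_top. 0 < q r"
    and lim: "((\<lambda>r. ln (q r) / r) \<longlongrightarrow> L) at_top"
  shows "Limsup at_top (\<lambda>r. ereal (1 / r) * log_prob (p r)) \<le> ereal L"
proof -
  have "Limsup at_top (\<lambda>r. ereal (1 / r) * log_prob (p r)) \<le> Limsup at_top (\<lambda>r. ereal (ln (q r) / r))"
  proof (rule Limsup_mono)
    show "\<forall>\<^sub>F r in at_top. ereal (1 / r) * log_prob (p r) \<le> ereal (ln (q r) / r)"
      using p q eventually_gt_at_top[of 0]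
    proof eventually_elim
      case (elim r)
      then show ?case by (cases "p r = 0") (auto simp: log_prob_def divide_right_mono)
    qed
  qed
  also have "\<dots> = ereal L" using lim by (intro lim_imp_Limsup) auto
  finally show ?thesis .
qed

lemma Liminf_log_prob_ge:
  assumes p: "\<forall>\<^sub>F r in at_top. q r \<le> p r" and q: "\<forall>\<^sub>F r in at_top. 0 < q r"
    and lim: "((\<lambda>r. ln (q r) / r) \<longlongrightarrow> L) at_top"
  shows "ereal L \<le> Liminf at_top (\<lambda>r. ereal (1 / r) * log_prob (p r))"
proof -
  have "ereal L = Liminf at_top (\<lambda>r. ereal (ln (q r) / r))"
    using lim by (intro lim_imp_Liminf[symmetric]) auto
  also have "\<dots> \<le> Liminf at_top (\<lambda>r. ereal (1 / r) * log_prob (p r))"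
  proof (rule Liminf_mono)
    show "\<forall>\<^sub>F r in at_top. ereal (ln (q r) / r) \<le> ereal (1 / r) * log_prob (p r)"
      using p q eventually_gt_at_top[of 0]
    proof eventually_elim
      case (elim r)
      then show ?case by (auto simp: log_prob_def divide_right_mono)
    qed
  qed
  finally show ?thesis .
qed

lemma rate_J_ge: "ereal (\<mu>\<^sup>2 / 2 * b) \<le> rate_J \<mu> t b"
  by (simp add: rate_J_def)

text \<open>Inside \<open>[0, t]\<close> the rate function agrees with a linear function that it dominates everywhere;
outside, it is infinite on an open set.\<close>
lemma rate_J_lower_semicontinuous: "lower_semicontinuous (rate_J \<mu> t)"
  unfolding lower_semicontinuous_def
proof
  fix x
  show "rate_J \<mu> t x \<le> Liminf (at x) (rate_J \<mu> t)"
  proof (cases "x \<in> {0..t}")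
    case True
    have "((\<lambda>b. ereal (\<mu>\<^sup>2 / 2 * b)) \<longlongrightarrow> ereal (\<mu>\<^sup>2 / 2 * x)) (at x)"
      by (intro tendsto_intros)
    from lim_imp_Liminf[OF _ this] have "rate_J \<mu> t x = Liminf (at x) (\<lambda>b. ereal (\<mu>\<^sup>2 / 2 * b))"
      using True by (simp add: rate_J_def)
    also have "\<dots> \<le> Liminf (at x) (rate_J \<mu> t)"
      by (intro Liminf_mono always_eventually allI rate_J_ge)
    finally show ?thesis .
  next
    case False
    then have "\<forall>\<^sub>F b in at x. b \<in> - {0..t}"
      by (intro topological_tendstoD[OF tendsto_ident_at]) auto
    then have "\<forall>\<^sub>F b in at x. \<infinity> \<le> rate_J \<mu> t b"
      by eventually_elim (auto simp: rate_J_def)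
    then have "Liminf (at x) (\<lambda>_. \<infinity>) \<le> Liminf (at x) (rate_J \<mu> t)"
      by (rule Liminf_mono)
    then show ?thesis by (simp add: Liminf_const)
  qed
qed

lemma rate_J_good: "good_rate_function (rate_J \<mu> t)"
  unfolding good_rate_function_def
proof (intro allI impI)
  fix \<eta> :: real
  have "{w. rate_J \<mu> t w \<le> ereal \<eta>} = {0..t} \<inter> {w. \<mu>\<^sup>2 / 2 * w \<le> \<eta>}"
    by (auto simp: rate_J_def)
  moreover have "closed {w. \<mu>\<^sup>2 / 2 * w \<le> \<eta>}"
    by (intro closed_Collect_le continuous_intros)
  ultimately show "compact {w. rate_J \<mu> t w \<le> ereal \<eta>}"
    by (simp add: compact_Int_closed)
qed

section \<open>Large deviation principle\<close>

text \<open>The rate function is nondecreasing on \<open>[0, t]\<close>, so a cheapest point of \<open>C\<close> is the least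
element \<open>b\<close> of \<open>C \<inter> [0, t]\<close>, and the last zero lies in \<open>C\<close> only if it is at least \<open>b\<close>.\<close>
lemma LDP_upper_bound_last_zero:
  fixes \<mu> t :: real
  assumes t: "0 < t" and bm: "\<And>r. r > 0 \<Longrightarrow> standard_brownian_motion (M r) (B r)"
    and C: "closed C"
  defines "T \<equiv> \<lambda>r. last_zero (drifted (B r) (\<mu> * sqrt r)) t"
  shows "Limsup at_top (\<lambda>r. ereal (1 / r) * log_prob (measure (M r) {\<omega> \<in> space (M r). T r \<omega> \<in> C}))
    \<le> - (INF w\<in>C. rate_J \<mu> t w)"
proof -
  let ?p = "\<lambda>r. measure (M r) {\<omega> \<in> space (M r). T r \<omega> \<in> C}"
  have T: "T r \<omega> \<in> {0..t}" if "0 < r" "\<omega> \<in> space (M r)" for r \<omega>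
  proof -
    note bmr = bm[OF that(1)]
    have "continuous_on {0..t} (\<lambda>s. drifted (B r) (\<mu> * sqrt r) s \<omega>)"
      by (rule continuous_on_subset[OF drifted_continuous[OF bmr that(2)]]) auto
    then show ?thesis
      using last_zero_is_zero[where X = "drifted (B r) (\<mu> * sqrt r)"] bm_0[OF bmr that(2)] t
      by (simp add: T_def drifted_def)
  qed
  show ?thesis
  proof (cases "C \<inter> {0..t} = {}")
    case True
    have "\<forall>\<^sub>F r in at_top. ereal (1 / r) * log_prob (?p r) \<le> - \<infinity>"
      using eventually_gt_at_top[of "0::real"]
    proof eventually_elim
      case (elim r)
      have "{\<omega> \<in> space (M r). T r \<omega> \<in> C} = {}" using T[OF elim] True by blast
      then have "?p r = 0" by (metis measure_empty)
      then show ?case using elim by (simp add: log_prob_def)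
    qed
    then have "Limsup at_top (\<lambda>r. ereal (1 / r) * log_prob (?p r)) \<le> - \<infinity>"
      by (rule order_trans[OF Limsup_mono]) (simp add: Limsup_const)
    then show ?thesis by simp
  next
    case False
    define b where "b = Inf (C \<inter> {0..t})"
    have bdd: "bdd_below (C \<inter> {0..t})" by (rule bdd_belowI[of _ 0]) auto
    have b: "b \<in> C" "0 \<le> b" "b \<le> t"
      using closed_contains_Inf[OF False bdd closed_Int[OF C closed_atLeastAtMost]]
      by (auto simp: b_def)
    let ?q = "\<lambda>r. 2 * exp (- (\<mu>\<^sup>2 * r * b / 2))"
    have "?p r \<le> ?q r" if r: "0 < r" for r
    proof (cases "b = 0")
      case True
      show ?thesis
        using prob_space.prob_le_1[OF bm_prob_space[OF bm[OF r]], of "{\<omega> \<in> space (M r). T r \<omega> \<in> C}"] True by simp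
    next
      case False
      interpret prob_space "M r" by (rule bm_prob_space[OF bm[OF r]])
      have [measurable]: "T r \<in> borel_measurable (M r)"
        unfolding T_def by (rule last_zero_measurable[OF bm[OF r]]) (use t in simp)
      have "?p r \<le> measure (M r) {\<omega> \<in> space (M r). b \<le> T r \<omega>}"
        using T[OF r] bdd by (intro finite_measure_mono) (auto simp: b_def intro!: cInf_lower)
      also have "\<dots> \<le> 2 * exp (- ((\<mu> * sqrt r)\<^sup>2 * b / 2))"
        unfolding T_def by (rule prob_last_zero_ge_le[OF bm[OF r]]) (use t b False in auto)
      also have "\<dots> = ?q r" using r by (simp add: power_mult_distrib)
      finally show ?thesis .
    qed
    then have "\<forall>\<^sub>F r in at_top. 0 \<le> ?p r \<and> ?p r \<le> ?q r"
      by (intro eventually_mono[OF eventually_gt_at_top[of "0::real"]]) simp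
    moreover have "((\<lambda>r. ln (?q r) / r) \<longlongrightarrow> - (\<mu>\<^sup>2 / 2 * b)) at_top"
      by (simp add: ln_mult) real_asymp
    ultimately have "Limsup at_top (\<lambda>r. ereal (1 / r) * log_prob (?p r)) \<le> ereal (- (\<mu>\<^sup>2 / 2 * b))"
      by (intro Limsup_log_prob_le[where q = ?q]) auto
    also have "\<dots> = - rate_J \<mu> t b" using b by (simp add: rate_J_def)
    also have "\<dots> \<le> - (INF w\<in>C. rate_J \<mu> t w)"
      using b by (simp add: INF_lower)
    finally show ?thesis .
  qed
qed

lemma Liminf_log_prob_last_zero_between:
  fixes \<mu> t :: real
  assumes \<mu>: "\<mu> \<noteq> 0" and bm: "\<And>r. r > 0 \<Longrightarrow> standard_brownian_motion (M r) (B r)"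
    and ac: "0 < a" "a < c" "c < t"
  shows "ereal (- (\<mu>\<^sup>2 / 2 * a)) \<le> Liminf at_top (\<lambda>r. ereal (1 / r) * log_prob
    (measure (M r) {\<omega> \<in> space (M r). last_zero (drifted (B r) (\<mu> * sqrt r)) t \<omega> \<in> {a..c}}))"
proof -
  define m d where "m = \<bar>\<mu>\<bar>" and "d = c - a"
  have pos: "0 < m" "0 < d" using \<mu> ac by (auto simp: m_def d_def)
  let ?q = "\<lambda>r. normal_density 0 (sqrt a) (m * sqrt r * a + 1) * (1 / 2)"
  have "((\<lambda>r. exp (m * sqrt r - m\<^sup>2 * r * d / 2)) \<longlongrightarrow> 0) at_top"
    using pos by real_asymp
  \<comment> \<open>The threshold \<open>1 / 4\<close> leaves the factor \<open>1 / 2\<close> that appears in \<open>?q\<close>.\<close>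
  then have "\<forall>\<^sub>F r in at_top. exp (m * sqrt r - m\<^sup>2 * r * d / 2) < 1 / 4"
    by (rule order_tendstoD) simp
  then have "\<forall>\<^sub>F r in at_top. ?q r \<le> measure (M r) {\<omega> \<in> space (M r). last_zero (drifted (B r) (\<mu> * sqrt r)) t \<omega> \<in> {a..c}}"
    using eventually_gt_at_top[of "0::real"]
  proof eventually_elim
    case (elim r)
    have "\<bar>\<mu> * sqrt r\<bar> = m * sqrt r" "(\<mu> * sqrt r)\<^sup>2 = m\<^sup>2 * r"
      using elim by (simp_all add: m_def abs_mult power_mult_distrib)
    with prob_last_zero_between_ge[OF bm[OF elim(2)] ac, of "\<mu> * sqrt r"]
    have "normal_density 0 (sqrt a) (m * sqrt r * a + 1) * (1 - 2 * exp (m * sqrt r - m\<^sup>2 * r * d / 2))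
      \<le> measure (M r) {\<omega> \<in> space (M r). last_zero (drifted (B r) (\<mu> * sqrt r)) t \<omega> \<in> {a..c}}"
      by (simp add: d_def)
    moreover have "?q r \<le> normal_density 0 (sqrt a) (m * sqrt r * a + 1) * (1 - 2 * exp (m * sqrt r - m\<^sup>2 * r * d / 2))"
      using elim(1) by (intro mult_left_mono) auto
    ultimately show ?case by linarith
  qed
  moreover have "((\<lambda>r. ln (?q r) / r) \<longlongrightarrow> - (\<mu>\<^sup>2 / 2 * a)) at_top"
  proof -
    have "ln (?q r) = - ((m * sqrt r * a + 1)\<^sup>2 / (2 * a)) - ln (2 * sqrt (2 * pi * a))" for r
      using ac(1) by (simp add: normal_density_def ln_mult ln_div)
    moreover have "((\<lambda>r. (- ((m * sqrt r * a + 1)\<^sup>2 / (2 * a)) - ln (2 * sqrt (2 * pi * a))) / r)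
        \<longlongrightarrow> - (m\<^sup>2 / 2 * a)) at_top"
      using pos ac(1) by (real_asymp simp: power2_eq_square)
    ultimately show ?thesis by (simp add: m_def)
  qed
  moreover have "0 < ?q r" for r using ac(1) by (simp add: normal_density_pos)
  ultimately show ?thesis by (intro Liminf_log_prob_ge[where q = ?q]) auto
qed

text \<open>Every point \<open>w\<close> of \<open>G \<inter> [0, t]\<close>, the end points included, is a limit of left ends of intervals
\<open>[a, c]\<close> that lie in \<open>G\<close> and in the interior of \<open>[0, t]\<close>; the rate of such an interval tends to the
rate at \<open>w\<close>.\<close>
lemma LDP_lower_bound_last_zero:
  fixes \<mu> t :: real
  assumes \<mu>: "\<mu> \<noteq> 0" and t: "0 < t" and bm: "\<And>r. r > 0 \<Longrightarrow> standard_brownian_motion (M r) (B r)"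
    and G: "open G"
  defines "T \<equiv> \<lambda>r. last_zero (drifted (B r) (\<mu> * sqrt r)) t"
  shows "- (INF w\<in>G. rate_J \<mu> t w)
    \<le> Liminf at_top (\<lambda>r. ereal (1 / r) * log_prob (measure (M r) {\<omega> \<in> space (M r). T r \<omega> \<in> G}))"
    (is "_ \<le> ?L")
proof -
  have mono: "log_prob p \<le> log_prob q" if "0 \<le> p" "p \<le> q" for p q
    using that by (auto simp: log_prob_def)
  have between: "ereal (- (\<mu>\<^sup>2 / 2 * a)) \<le> ?L"
    if "0 < a" "a < c" "c < t" "{a..c} \<subseteq> G" for a c
  proof -
    have "ereal (- (\<mu>\<^sup>2 / 2 * a)) \<le> Liminf at_top (\<lambda>r. ereal (1 / r) * log_prob
        (measure (M r) {\<omega> \<in> space (M r). T r \<omega> \<in> {a..c}}))"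
      unfolding T_def by (rule Liminf_log_prob_last_zero_between[OF \<mu> bm that(1-3)])
    also have "\<dots> \<le> ?L"
    proof (rule Liminf_mono)
      show "\<forall>\<^sub>F r in at_top. ereal (1 / r) * log_prob (measure (M r) {\<omega> \<in> space (M r). T r \<omega> \<in> {a..c}})
        \<le> ereal (1 / r) * log_prob (measure (M r) {\<omega> \<in> space (M r). T r \<omega> \<in> G})"
        using eventually_gt_at_top[of "0::real"]
      proof eventually_elim
        case (elim r)
        interpret prob_space "M r" by (rule bm_prob_space[OF bm[OF elim]])
        have [measurable]: "T r \<in> borel_measurable (M r)"
          unfolding T_def by (rule last_zero_measurable[OF bm[OF elim]]) (use t in simp)
        have "{\<omega> \<in> space (M r). T r \<omega> \<in> G} \<in> sets (M r)"
          using measurable_sets[OF _ borel_open[OF G], of "T r" "M r"]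
          by (simp add: vimage_def Int_def conj_commute)
        then have "measure (M r) {\<omega> \<in> space (M r). T r \<omega> \<in> {a..c}} \<le> measure (M r) {\<omega> \<in> space (M r). T r \<omega> \<in> G}"
          using that(4) by (intro finite_measure_mono) auto
        then show ?case
          using elim by (intro ereal_mult_left_mono mono) auto
      qed
    qed
    finally show ?thesis .
  qed
  have "- ?L \<le> rate_J \<mu> t w" if w: "w \<in> G" for w
  proof (cases "w \<in> {0..t}")
    case True
    obtain e where e: "0 < e" "ball w e \<subseteq> G"
      using G w open_contains_ball by metis
    have "- (ereal (\<mu>\<^sup>2 / 2 * w)) \<le> ?L"
    proof (rule ereal_le_epsilon2)
      fix d :: real assume d: "0 < d"
      \<comment> \<open>The distance allowed around \<open>w\<close>: within \<open>G\<close>, and changing the rate by at most \<open>d\<close>.\<close>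
      define f where "f = min e (2 * d / \<mu>\<^sup>2)"
      have f: "0 < f" "f \<le> e" "\<mu>\<^sup>2 / 2 * f \<le> d"
        using e(1) d \<mu> by (auto simp: f_def min_def field_simps)
      have "max 0 (w - f) < min t (w + f)" using t True f(1) by auto
      then obtain a where a: "max 0 (w - f) < a" "a < min t (w + f)" using dense by blast
      then obtain c where c: "a < c" "c < min t (w + f)" using dense by blast
      have "{a..c} \<subseteq> ball w e" using a c f(2) by (auto simp: dist_real_def)
      then have "ereal (- (\<mu>\<^sup>2 / 2 * a)) \<le> ?L"
        using a c e(2) by (intro between[of a c]) auto
      have "\<mu>\<^sup>2 / 2 * a \<le> \<mu>\<^sup>2 / 2 * (w + f)"
        using a by (intro mult_left_mono) auto
      then have "- (\<mu>\<^sup>2 / 2 * w) \<le> - (\<mu>\<^sup>2 / 2 * a) + d"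
        using f(3) unfolding distrib_left by linarith
      then have "- ereal (\<mu>\<^sup>2 / 2 * w) \<le> ereal (- (\<mu>\<^sup>2 / 2 * a)) + ereal d" by simp
      also have "\<dots> \<le> ?L + ereal d"
        by (rule add_right_mono) (rule \<open>ereal (- (\<mu>\<^sup>2 / 2 * a)) \<le> ?L\<close>)
      finally show "- ereal (\<mu>\<^sup>2 / 2 * w) \<le> ?L + ereal d" .
    qed
    then have "- ?L \<le> ereal (\<mu>\<^sup>2 / 2 * w)" by (simp add: ereal_uminus_le_reorder)
    then show ?thesis using True by (simp add: rate_J_def)
  qed (auto simp: rate_J_def)
  then have "- ?L \<le> (INF w\<in>G. rate_J \<mu> t w)" by (rule INF_greatest)
  then show ?thesis by (simp add: ereal_uminus_le_reorder)
qed

theorem proposition2p1: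
  fixes \<mu> t :: real
    and M :: "real \<Rightarrow> 'a measure"
    and B :: "real \<Rightarrow> real \<Rightarrow> 'a \<Rightarrow> real"
  assumes "\<mu> \<noteq> 0" and "t > 0"
    and "\<And>r. r > 0 \<Longrightarrow> standard_brownian_motion (M r) (B r)"
  shows "satisfies_LDP M (\<lambda>r. last_zero (drifted (B r) (\<mu> * sqrt r)) t) (\<lambda>r. r) (rate_J \<mu> t)
         \<and> good_rate_function (rate_J \<mu> t)"
  unfolding satisfies_LDP_def
proof (intro conjI allI impI)
  fix r :: real assume "0 < r"
  note bm = assms(3)[OF this]
  show "prob_space (M r)" by (rule bm_prob_space[OF bm])
  show "last_zero (drifted (B r) (\<mu> * sqrt r)) t \<in> borel_measurable (M r)"
    using assms(2) by (intro last_zero_measurable[OF bm]) simp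
next
  show "0 \<le> rate_J \<mu> t x" for x by (simp add: rate_J_def)
qed (auto intro: filterlim_ident rate_J_lower_semicontinuous rate_J_good
    LDP_upper_bound_last_zero[OF assms(2,3)] LDP_lower_bound_last_zero[OF assms])

end
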